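(* Let $\mathcal{M}$ be a pointed model and let $k \geq 0$. Then $\mathcal{M}$ is $k$-bisimilar to its rooted $k$-contraction.
   Context: Fix a countable set $\mathcal{P}$ of atomic propositions and a finite set $\mathcal{I}$ of modality indices. A model is $M=(W,R,V)$ with $W$ finite nonempty, $R_i\subseteq W\times W$ for $i\in\mathcal{I}$, $V:\mathcal{P}\to2^W$; a pointed model is $(M,w_d)$ with $w_d\in W$. For $k\ge0$, a $k$-bisimulation between $(M,w_d)$ and $(M',w'_d)$ is a sequence of nonempty relations $Z_k\subseteq\cdots\subseteq Z_0\subseteq W\times W'$ with $(w_d,w'_d)\in Z_k$ such that pairs in $Z_0$ agree on all atoms, and for all $h<k$: if $(w,w')\in Z_{h+1}$ and $wR_iv$ then some $v'$ has $w'R'_iv'$, $(v,v')\in Z_h$ (forth), and symmetrically (back). $k$-bisimilar means such a sequence exists; for worlds of one model, $w\sim_hv$ means $(M,w)$ and $(M,v)$ are $h$-bisimilar, and $[w]_h=\{v\in W\mid w\sim_hv\}$. With respect to $\mathcal{M}=(M,w_d)$ and $k$: depth $d(w)$ = length of a shortest path from $w_d$ to $w$ along edges of any $R_i$ ($\infty$ if none); bound $b(w)=k-d(w)$. For $x,y$ with nonnegative bound, $x\succ y$ iff $b(x)>b(y)$ and $x\sim_{b(y)}y$. $\mathrm{Max}(W)=\{x\in W\mid b(x)\ge0$ and no $y\in W$ has $y\succ x\}$. The rooted $k$-contraction of $\mathcal{M}$ is $((W',R',V'),[w_d]_{b(w_d)})$ with $W'=\{[x]_{b(x)}\mid x\in\mathrm{Max}(W)\}$,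 $R'_i=\{([x]_{b(x)},[y]_{b(y)})\mid x,y\in\mathrm{Max}(W),\ \exists z\,(xR_iz\text{ and }y\sim_{b(x)-1}z),\ b(x)>0\}$, $V'(p)=\{[x]_{b(x)}\mid x\in\mathrm{Max}(W),\ x\in V(p)\}$. *)

theory Defs
  imports "HOL-Library.Countable_Set" "HOL-Library.Extended_Nat" "HOL-Library.Extended"
begin

text \<open>
  The atoms are a set \<open>P\<close> and the modality indices a set \<open>I\<close>, passed as explicit parameters
  (so either may be empty). The values of \<open>rel\<close> outside \<open>I\<close> and of \<open>val\<close> outside \<open>P\<close> are irrelevant.
\<close>

record ('w, 'i, 'p) model =
  worlds :: "'w set"
  rel :: "'i \<Rightarrow> ('w \<times> 'w) set"
  val :: "'p \<Rightarrow> 'w set"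

type_synonym ('w, 'i, 'p) pointed = "('w, 'i, 'p) model \<times> 'w"

definition is_model :: "'p set \<Rightarrow> 'i set \<Rightarrow> ('w, 'i, 'p) model \<Rightarrow> bool" where
  "is_model P I M \<longleftrightarrow>
     finite (worlds M) \<and> worlds M \<noteq> {} \<and>
     (\<forall>i\<in>I. rel M i \<subseteq> worlds M \<times> worlds M) \<and>
     (\<forall>p\<in>P. val M p \<subseteq> worlds M)"

definition is_pointed_model :: "'p set \<Rightarrow> 'i set \<Rightarrow> ('w, 'i, 'p) pointed \<Rightarrow> bool" where
  "is_pointed_model P I = (\<lambda>(M, wd). is_model P I M \<and> wd \<in> worlds M)"

text \<open>The sequence of relations is a function \<open>Z\<close>, of which only \<open>Z 0, \<dots>, Z k\<close> matter.\<close>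

definition k_bisimulation ::
  "'p set \<Rightarrow> 'i set \<Rightarrow> nat \<Rightarrow> ('w, 'i, 'p) pointed \<Rightarrow> ('v, 'i, 'p) pointed
     \<Rightarrow> (nat \<Rightarrow> ('w \<times> 'v) set) \<Rightarrow> bool" where
  "k_bisimulation P I k = (\<lambda>(M, wd) (M', wd') Z.
     (\<forall>h\<le>k. Z h \<noteq> {}) \<and>
     (\<forall>h<k. Z (Suc h) \<subseteq> Z h) \<and>
     Z 0 \<subseteq> worlds M \<times> worlds M' \<and>
     (wd, wd') \<in> Z k \<and>
     (\<forall>(w, w')\<in>Z 0. \<forall>p\<in>P. w \<in> val M p \<longleftrightarrow> w' \<in> val M' p) \<and>
     (\<forall>h<k. \<forall>(w, w')\<in>Z (Suc h). \<forall>i\<in>I.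
        (\<forall>v. (w, v) \<in> rel M i \<longrightarrow> (\<exists>v'. (w', v') \<in> rel M' i \<and> (v, v') \<in> Z h)) \<and>
        (\<forall>v'. (w', v') \<in> rel M' i \<longrightarrow> (\<exists>v. (w, v) \<in> rel M i \<and> (v, v') \<in> Z h))))"

definition k_bisimilar ::
  "'p set \<Rightarrow> 'i set \<Rightarrow> nat \<Rightarrow> ('w, 'i, 'p) pointed \<Rightarrow> ('v, 'i, 'p) pointed \<Rightarrow> bool" where
  "k_bisimilar P I k MM MM' \<longleftrightarrow> (\<exists>Z. k_bisimulation P I k MM MM' Z)"

definition world_bisim ::
  "'p set \<Rightarrow> 'i set \<Rightarrow> ('w, 'i, 'p) model \<Rightarrow> nat \<Rightarrow> 'w \<Rightarrow> 'w \<Rightarrow> bool" where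
  "world_bisim P I M h w v \<longleftrightarrow> k_bisimilar P I h (M, w) (M, v)"

definition bisim_class ::
  "'p set \<Rightarrow> 'i set \<Rightarrow> ('w, 'i, 'p) model \<Rightarrow> nat \<Rightarrow> 'w \<Rightarrow> 'w set" where
  "bisim_class P I M h w = {v \<in> worlds M. world_bisim P I M h w v}"

text \<open>The infimum of the empty set is \<open>\<infinity>\<close>.\<close>

definition depth :: "'i set \<Rightarrow> ('w, 'i, 'p) pointed \<Rightarrow> 'w \<Rightarrow> enat" where
  "depth I = (\<lambda>(M, wd) w. INF n \<in> {n. (wd, w) \<in> (\<Union>i\<in>I. rel M i) ^^ n}. enat n)"

text \<open>Bounds \<open>k - d(w)\<close> may be negative, and are \<open>-\<infinity>\<close> (\<open>Minf\<close>) for unreachable worlds.\<close>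

definition bound :: "'i set \<Rightarrow> nat \<Rightarrow> ('w, 'i, 'p) pointed \<Rightarrow> 'w \<Rightarrow> int extended" where
  "bound I k MM w =
     Fin (int k) - (case depth I MM w of enat n \<Rightarrow> Fin (int n) | \<infinity> \<Rightarrow> Pinf)"

text \<open>A nonnegative bound as a bisimulation level; applied below only to nonnegative arguments.\<close>

definition level :: "int extended \<Rightarrow> nat" where
  "level b = (case b of Fin m \<Rightarrow> nat m | _ \<Rightarrow> 0)"

definition dominates ::
  "'p set \<Rightarrow> 'i set \<Rightarrow> nat \<Rightarrow> ('w, 'i, 'p) pointed \<Rightarrow> 'w \<Rightarrow> 'w \<Rightarrow> bool" where
  "dominates P I k MM x y \<longleftrightarrow>
     bound I k MM x \<ge> 0 \<and> bound I k MM y \<ge> 0 \<and>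
     bound I k MM x > bound I k MM y \<and>
     world_bisim P I (fst MM) (level (bound I k MM y)) x y"

definition max_worlds ::
  "'p set \<Rightarrow> 'i set \<Rightarrow> nat \<Rightarrow> ('w, 'i, 'p) pointed \<Rightarrow> 'w set" where
  "max_worlds P I k MM =
     {x \<in> worlds (fst MM). bound I k MM x \<ge> 0 \<and>
        \<not> (\<exists>y \<in> worlds (fst MM). dominates P I k MM y x)}"

definition rep_class ::
  "'p set \<Rightarrow> 'i set \<Rightarrow> nat \<Rightarrow> ('w, 'i, 'p) pointed \<Rightarrow> 'w \<Rightarrow> 'w set" where
  "rep_class P I k MM x = bisim_class P I (fst MM) (level (bound I k MM x)) x"

definition rooted_contraction ::
  "'p set \<Rightarrow> 'i set \<Rightarrow> nat \<Rightarrow> ('w, 'i, 'p) pointed \<Rightarrow> ('w set, 'i, 'p) pointed" where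
  "rooted_contraction P I k MM =
     (\<lparr> worlds = {rep_class P I k MM x | x. x \<in> max_worlds P I k MM},
        rel = (\<lambda>i. {(rep_class P I k MM x, rep_class P I k MM y) | x y.
                 x \<in> max_worlds P I k MM \<and> y \<in> max_worlds P I k MM \<and>
                 (\<exists>z. (x, z) \<in> rel (fst MM) i \<and>
                      world_bisim P I (fst MM) (level (bound I k MM x - 1)) y z) \<and>
                 bound I k MM x > 0}),
        val = (\<lambda>p. {rep_class P I k MM x | x.
                 x \<in> max_worlds P I k MM \<and> x \<in> val (fst MM) p}) \<rparr>,
      rep_class P I k MM (snd MM))"

text \<open>The construction yields a pointed model.\<close>

lemma depth_root: "depth I (M, wd) wd = 0"
proof -
  have "(INF n \<in> {n. (wd, wd) \<in> (\<Union>i\<in>I. rel M i) ^^ n}. enat n) \<le> enat 0"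
    by (rule INF_lower) simp
  then show ?thesis by (simp add: depth_def zero_enat_def[symmetric])
qed

lemma bound_root: "bound I k (M, wd) wd = Fin (int k)"
  by (simp add: bound_def depth_root zero_enat_def)

lemma bound_le: "bound I k MM w \<le> Fin (int k)"
  by (cases "depth I MM w") (simp_all add: bound_def)

lemma root_in_max_worlds:
  assumes "is_pointed_model P I (M, wd)"
  shows "wd \<in> max_worlds P I k (M, wd)"
  using assms bound_le[of I k "(M, wd)"]
  by (auto simp: max_worlds_def is_pointed_model_def bound_root dominates_def
      zero_extended_def leD)

lemma rooted_contraction_is_pointed_model:
  assumes "is_pointed_model P I (M, wd)"
  shows "is_pointed_model P I (rooted_contraction P I k (M, wd))"
proof -
  have "finite (max_worlds P I k (M, wd))"
    using assms by (auto simp: is_pointed_model_def is_model_def max_worlds_def)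
  then show ?thesis
    using root_in_max_worlds[OF assms, of k]
    by (auto simp: is_pointed_model_def is_model_def rooted_contraction_def)
qed

end

theory Submission
  imports Defs
begin

text \<open>
  Relate \<open>x\<close> to the class of a maximal world \<open>y\<close> at level \<open>h\<close> whenever \<open>h \<le> b(y)\<close> and
  \<open>x \<sim>\<^sub>h y\<close>. For forth, a successor of a world of bound \<open>b\<close> has bound at least \<open>b - 1\<close>, and every
  world \<open>u\<close> of nonnegative bound is \<open>b(u)\<close>-bisimilar to a maximal world of at least that bound.
  For back, a maximal \<open>y\<close> with \<open>y \<sim> z\<close> at level \<open>m \<le> b(z)\<close> has \<open>b(y) \<ge> m\<close>, since otherwise \<open>z\<close>
  would dominate it. The contraction is independent of the chosen representatives because
  maximal worlds with the same class have the same bound.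
\<close>

section \<open>Bisimilarity of bounded depth\<close>

text \<open>Asking for the distinguished pair at every level, not only at \<open>k\<close>, also
  settles the nonemptiness of all the relations.\<close>

lemma k_bisimulationI:
  assumes "\<And>h. h < k \<Longrightarrow> Z (Suc h) \<subseteq> Z h"
    and "\<And>h. h \<le> k \<Longrightarrow> (wd, wd') \<in> Z h"
    and "Z 0 \<subseteq> worlds M \<times> worlds M'"
    and "\<And>w w' p. (w, w') \<in> Z 0 \<Longrightarrow> p \<in> P \<Longrightarrow> w \<in> val M p \<longleftrightarrow> w' \<in> val M' p"
    and "\<And>h w w' i v. h < k \<Longrightarrow> (w, w') \<in> Z (Suc h) \<Longrightarrow> i \<in> I \<Longrightarrow> (w, v) \<in> rel M i \<Longrightarrow>
      \<exists>v'. (w', v') \<in> rel M' i \<and> (v, v') \<in> Z h"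
    and "\<And>h w w' i v'. h < k \<Longrightarrow> (w, w') \<in> Z (Suc h) \<Longrightarrow> i \<in> I \<Longrightarrow> (w', v') \<in> rel M' i \<Longrightarrow>
      \<exists>v. (w, v) \<in> rel M i \<and> (v, v') \<in> Z h"
  shows "k_bisimulation P I k (M, wd) (M', wd') Z"
  unfolding k_bisimulation_def split
proof (intro conjI)
  show "\<forall>h\<le>k. Z h \<noteq> {}" using assms(2) by blast
  show "\<forall>h<k. Z (Suc h) \<subseteq> Z h" using assms(1) by blast
  show "Z 0 \<subseteq> worlds M \<times> worlds M'" by (fact assms(3))
  show "(wd, wd') \<in> Z k" using assms(2) by blast
  show "\<forall>(w, w')\<in>Z 0. \<forall>p\<in>P. w \<in> val M p \<longleftrightarrow> w' \<in> val M' p" using assms(4) by blast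
  show "\<forall>h<k. \<forall>(w, w')\<in>Z (Suc h). \<forall>i\<in>I.
      (\<forall>v. (w, v) \<in> rel M i \<longrightarrow> (\<exists>v'. (w', v') \<in> rel M' i \<and> (v, v') \<in> Z h)) \<and>
      (\<forall>v'. (w', v') \<in> rel M' i \<longrightarrow> (\<exists>v. (w, v) \<in> rel M i \<and> (v, v') \<in> Z h))"
    by safe (rule assms(5), assumption+, rule assms(6), assumption+)
qed

lemma k_bisimulationD:
  assumes "k_bisimulation P I k (M, wd) (M', wd') Z"
  shows "h < k \<Longrightarrow> Z (Suc h) \<subseteq> Z h"
    and "(wd, wd') \<in> Z k"
    and "Z 0 \<subseteq> worlds M \<times> worlds M'"
    and "(w, w') \<in> Z 0 \<Longrightarrow> p \<in> P \<Longrightarrow> w \<in> val M p \<longleftrightarrow> w' \<in> val M' p"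
    and "h < k \<Longrightarrow> (w, w') \<in> Z (Suc h) \<Longrightarrow> i \<in> I \<Longrightarrow> (w, v) \<in> rel M i \<Longrightarrow>
      \<exists>v'. (w', v') \<in> rel M' i \<and> (v, v') \<in> Z h"
    and "h < k \<Longrightarrow> (w, w') \<in> Z (Suc h) \<Longrightarrow> i \<in> I \<Longrightarrow> (w', v') \<in> rel M' i \<Longrightarrow>
      \<exists>v. (w, v) \<in> rel M i \<and> (v, v') \<in> Z h"
  using assms unfolding k_bisimulation_def split
  by (blast, blast, blast, blast, (elim conjE allE[of _ h], fastforce)+)

lemma k_bisimulation_chain:
  assumes Z: "k_bisimulation P I k (M, w) (M', w') Z" and "m \<le> n" "n \<le> k"
  shows "Z n \<subseteq> Z m"
  using assms(2,3)
proof (induction n rule: dec_induct)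
  case (step n)
  then show ?case using k_bisimulationD(1)[OF Z, of n] by auto
qed simp

lemma k_bisimulation_pair:
  assumes "k_bisimulation P I k (M, w) (M', w') Z" "n \<le> k"
  shows "(w, w') \<in> Z n"
  using k_bisimulation_chain[OF assms order_refl] k_bisimulationD(2)[OF assms(1)] by blast

text \<open>The first \<open>n\<close> levels may be recentred at any pair of \<open>Z n\<close>.
  The same pair at a smaller level gives monotonicity; a pair of successors gives forth for
  \<open>world_bisim\<close>.\<close>

lemma k_bisimulation_restrict:
  assumes Z: "k_bisimulation P I k (M, w) (M', w') Z" and "n \<le> k" "(v, v') \<in> Z n"
  shows "k_bisimulation P I n (M, v) (M', v') Z"
proof (rule k_bisimulationI)
  show "(v, v') \<in> Z h" if "h \<le> n" for h
    using k_bisimulation_chain[OF Z that \<open>n \<le> k\<close>] assms(3) by blast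
  show "Z (Suc h) \<subseteq> Z h" if "h < n" for h
    using k_bisimulationD(1)[OF Z] that \<open>n \<le> k\<close> by simp
  show "\<exists>b'. (a', b') \<in> rel M' i \<and> (b, b') \<in> Z h"
    if "h < n" "(a, a') \<in> Z (Suc h)" "i \<in> I" "(a, b) \<in> rel M i" for h a a' i b
    using k_bisimulationD(5)[OF Z _ that(2-4)] that(1) \<open>n \<le> k\<close> by simp
  show "\<exists>b. (a, b) \<in> rel M i \<and> (b, b') \<in> Z h"
    if "h < n" "(a, a') \<in> Z (Suc h)" "i \<in> I" "(a', b') \<in> rel M' i" for h a a' i b'
    using k_bisimulationD(6)[OF Z _ that(2-4)] that(1) \<open>n \<le> k\<close> by simp
qed (rule k_bisimulationD[OF Z]; assumption)+

section \<open>Bisimilarity of worlds of one model\<close>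

lemma world_bisimI: "k_bisimulation P I h (M, w) (M, v) Z \<Longrightarrow> world_bisim P I M h w v"
  by (auto simp: world_bisim_def k_bisimilar_def)

lemma world_bisimE:
  assumes "world_bisim P I M h w v"
  obtains Z where "k_bisimulation P I h (M, w) (M, v) Z"
  using assms by (auto simp: world_bisim_def k_bisimilar_def)

lemma world_bisim_refl:
  assumes "is_model P I M" "w \<in> worlds M"
  shows "world_bisim P I M h w w"
proof -
  have "rel M i \<subseteq> worlds M \<times> worlds M" if "i \<in> I" for i
    using assms(1) that by (simp add: is_model_def)
  then have "k_bisimulation P I h (M, w) (M, w) (\<lambda>_. Id_on (worlds M))"
    using assms(2) by (intro k_bisimulationI) (auto simp: Id_on_iff)
  then show ?thesis by (rule world_bisimI)
qed

text \<open>Taking converses exchanges forth and back.\<close>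

lemma world_bisim_sym:
  assumes "world_bisim P I M h w v"
  shows "world_bisim P I M h v w"
proof -
  obtain Z where Z: "k_bisimulation P I h (M, w) (M, v) Z"
    using assms by (rule world_bisimE)
  have "k_bisimulation P I h (M, v) (M, w) (\<lambda>n. (Z n)\<inverse>)"
    using k_bisimulationD[OF Z] k_bisimulation_pair[OF Z]
    by (intro k_bisimulationI) (simp_all, blast)
  then show ?thesis by (rule world_bisimI)
qed

lemma world_bisim_mono:
  assumes "world_bisim P I M h w v" "n \<le> h"
  shows "world_bisim P I M n w v"
proof -
  obtain Z where Z: "k_bisimulation P I h (M, w) (M, v) Z"
    using assms(1) by (rule world_bisimE)
  show ?thesis
    by (rule world_bisimI[OF k_bisimulation_restrict[OF Z assms(2) k_bisimulation_pair[OF Z assms(2)]]])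
qed

text \<open>The two sequences are composed level by level: forth passes through the middle world
  from left to right, back from right to left.\<close>

lemma world_bisim_trans:
  assumes "world_bisim P I M h w v" "world_bisim P I M h v u"
  shows "world_bisim P I M h w u"
proof -
  obtain Y Z where Y: "k_bisimulation P I h (M, w) (M, v) Y"
    and Z: "k_bisimulation P I h (M, v) (M, u) Z"
    using assms by (auto simp: world_bisim_def k_bisimilar_def)
  have pair: "(w, u) \<in> Y n O Z n" if "n \<le> h" for n
    using k_bisimulation_pair[OF Y that] k_bisimulation_pair[OF Z that] by blast
  have atoms: "a \<in> val M p \<longleftrightarrow> c \<in> val M p"
    if "(a, c) \<in> Y 0 O Z 0" "p \<in> P" for a c p
    using that k_bisimulationD(4)[OF Y] k_bisimulationD(4)[OF Z] by blast
  have sub: "Y (Suc n) O Z (Suc n) \<subseteq> Y n O Z n" if "n < h" for n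
    using k_bisimulation_chain[OF Y, of n "Suc n"] k_bisimulation_chain[OF Z, of n "Suc n"] that
    by (intro relcomp_mono) auto
  have forward: "\<exists>c'. (c, c') \<in> rel M i \<and> (a', c') \<in> Y n O Z n"
    if prem: "n < h" "(a, c) \<in> Y (Suc n) O Z (Suc n)" "i \<in> I" "(a, a') \<in> rel M i" for n a c i a'
  proof -
    obtain b where b: "(a, b) \<in> Y (Suc n)" "(b, c) \<in> Z (Suc n)" using prem by blast
    obtain b' where b': "(b, b') \<in> rel M i" "(a', b') \<in> Y n"
      using k_bisimulationD(5)[OF Y prem(1) b(1) prem(3,4)] by blast
    obtain c' where "(c, c') \<in> rel M i" "(b', c') \<in> Z n"
      using k_bisimulationD(5)[OF Z prem(1) b(2) prem(3) b'(1)] by blast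
    then show ?thesis using b' by blast
  qed
  have backward: "\<exists>a'. (a, a') \<in> rel M i \<and> (a', c') \<in> Y n O Z n"
    if prem: "n < h" "(a, c) \<in> Y (Suc n) O Z (Suc n)" "i \<in> I" "(c, c') \<in> rel M i" for n a c i c'
  proof -
    obtain b where b: "(a, b) \<in> Y (Suc n)" "(b, c) \<in> Z (Suc n)" using prem by blast
    obtain b' where b': "(b, b') \<in> rel M i" "(b', c') \<in> Z n"
      using k_bisimulationD(6)[OF Z prem(1) b(2) prem(3,4)] by blast
    obtain a' where "(a, a') \<in> rel M i" "(a', b') \<in> Y n"
      using k_bisimulationD(6)[OF Y prem(1) b(1) prem(3) b'(1)] by blast
    then show ?thesis using b' by blast
  qed
  have dom: "Y 0 O Z 0 \<subseteq> worlds M \<times> worlds M"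
    using k_bisimulationD(3)[OF Y] k_bisimulationD(3)[OF Z] by blast
  have "k_bisimulation P I h (M, w) (M, u) (\<lambda>n. Y n O Z n)"
    by (rule k_bisimulationI[OF sub pair dom atoms forward backward])
  then show ?thesis by (rule world_bisimI)
qed

text \<open>The back direction is obtained from this one through
  \<open>world_bisim_sym\<close>.\<close>

lemma world_bisim_forth:
  assumes "world_bisim P I M (Suc h) w v" "i \<in> I" "(w, w') \<in> rel M i"
  shows "\<exists>v'. (v, v') \<in> rel M i \<and> world_bisim P I M h w' v'"
proof -
  obtain Z where Z: "k_bisimulation P I (Suc h) (M, w) (M, v) Z"
    using assms(1) by (rule world_bisimE)
  obtain v' where v': "(v, v') \<in> rel M i" "(w', v') \<in> Z h"
    using k_bisimulationD(5)[OF Z lessI k_bisimulationD(2)[OF Z] assms(2,3)] by blast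
  have "k_bisimulation P I h (M, w') (M, v') Z"
    by (rule k_bisimulation_restrict[OF Z _ v'(2)]) simp
  then show ?thesis using v'(1) by (blast intro: world_bisimI)
qed

lemma world_bisim_worlds:
  assumes "world_bisim P I M h w v"
  shows "w \<in> worlds M" "v \<in> worlds M"
proof -
  obtain Z where Z: "k_bisimulation P I h (M, w) (M, v) Z"
    using assms by (rule world_bisimE)
  show "w \<in> worlds M" "v \<in> worlds M"
    using k_bisimulation_pair[OF Z, of 0] k_bisimulationD(3)[OF Z] by auto
qed

lemma world_bisim_val:
  assumes "world_bisim P I M h w v" "p \<in> P"
  shows "w \<in> val M p \<longleftrightarrow> v \<in> val M p"
proof -
  obtain Z where Z: "k_bisimulation P I h (M, w) (M, v) Z"
    using assms(1) by (rule world_bisimE)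
  show ?thesis
    using k_bisimulation_pair[OF Z, of 0] k_bisimulationD(4)[OF Z _ assms(2)] by auto
qed

section \<open>Bounds\<close>

lemma depth_le_iff:
  "depth I (M, wd) w \<le> enat n \<longleftrightarrow> (\<exists>m\<le>n. (wd, w) \<in> (\<Union>i\<in>I. rel M i) ^^ m)"
    (is "_ \<longleftrightarrow> (\<exists>m\<le>n. ?path m)")
proof
  assume le: "depth I (M, wd) w \<le> enat n"
  \<comment> \<open>Without any path the infimum would be infinite. A nonempty set in
    \<open>enat\<close> attains its infimum, so a shortest path exists.\<close>
  have "enat ` {m. ?path m} \<noteq> {}"
  proof
    assume "enat ` {m. ?path m} = {}"
    then have "depth I (M, wd) w = top" by (simp add: depth_def)
    then show False using le by (simp add: top_enat_def)
  qed
  then have "Inf (enat ` {m. ?path m}) \<in> enat ` {m. ?path m}"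
    by (metis (no_types, lifting) Inf_enat_def LeastI ex_in_conv)
  then show "\<exists>m\<le>n. ?path m" using le by (auto simp: depth_def)
next
  assume "\<exists>m\<le>n. ?path m"
  then obtain m where "m \<le> n" "?path m" by blast
  then have "depth I (M, wd) w \<le> enat m" by (auto simp: depth_def intro: INF_lower)
  then show "depth I (M, wd) w \<le> enat n" using \<open>m \<le> n\<close> by (meson enat_ord_simps(1) order_trans)
qed

lemma depth_successor:
  assumes "i \<in> I" "(x, z) \<in> rel M i" "depth I (M, wd) x \<le> enat n"
  shows "depth I (M, wd) z \<le> enat (Suc n)"
proof -
  obtain m where "m \<le> n" "(wd, x) \<in> (\<Union>i\<in>I. rel M i) ^^ m"
    using assms(3) unfolding depth_le_iff by blast
  moreover from this have "(wd, z) \<in> (\<Union>i\<in>I. rel M i) ^^ Suc m"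
    using assms(1,2) by auto
  ultimately show ?thesis unfolding depth_le_iff by (meson Suc_le_mono)
qed

text \<open>The upper bound \<open>k\<close> excludes \<open>Pinf\<close> and nonnegativity excludes
  \<open>Minf\<close>, so \<open>level\<close> loses no information on such bounds.\<close>

lemma bound_nonnegE:
  assumes "bound I k MM x \<ge> 0"
  obtains m where "bound I k MM x = Fin (int m)"
proof (cases "bound I k MM x")
  case (Fin a)
  then show ?thesis using assms that[of "nat a"] by (simp add: zero_extended_def)
next
  case Pinf
  then show ?thesis using bound_le[of I k MM x] by simp
next
  case Minf
  then show ?thesis using assms by (simp add: zero_extended_def)
qed

text \<open>The conjunct \<open>m \<le> k\<close> guards the truncated subtraction: for
  \<open>m > k\<close> the root would still satisfy the depth inequality.\<close>

lemma le_bound_iff: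
  "Fin (int m) \<le> bound I k MM x \<longleftrightarrow> m \<le> k \<and> depth I MM x \<le> enat (k - m)"
  by (cases "depth I MM x") (auto simp: bound_def)

text \<open>A path to \<open>x\<close> extends by one edge, so the depth grows by at most
  one.\<close>

lemma bound_successor:
  assumes "i \<in> I" "(x, z) \<in> rel M i" "Fin (int (Suc m)) \<le> bound I k (M, wd) x"
  shows "Fin (int m) \<le> bound I k (M, wd) z"
proof -
  have "Suc m \<le> k" "depth I (M, wd) x \<le> enat (k - Suc m)"
    using assms(3) unfolding le_bound_iff by auto
  moreover from this have "depth I (M, wd) z \<le> enat (Suc (k - Suc m))"
    using depth_successor[OF assms(1,2)] by blast
  ultimately show ?thesis unfolding le_bound_iff by (simp add: Suc_diff_Suc)
qed

section \<open>Passing from extended integer bounds to natural levels\<close>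

lemma le_level_iff:
  assumes "bound I k MM x \<ge> 0"
  shows "m \<le> level (bound I k MM x) \<longleftrightarrow> Fin (int m) \<le> bound I k MM x"
  using assms by (rule bound_nonnegE) (simp add: level_def)

lemma bound_less_iff:
  assumes "bound I k MM x \<ge> 0" "bound I k MM y \<ge> 0"
  shows "bound I k MM x < bound I k MM y \<longleftrightarrow> level (bound I k MM x) < level (bound I k MM y)"
proof -
  obtain m n where "bound I k MM x = Fin (int m)" "bound I k MM y = Fin (int n)"
    using assms by (elim bound_nonnegE)
  then show ?thesis by (simp add: level_def)
qed

text \<open>At bound 0 both sides are 0: \<open>level\<close> clips -1 just as subtraction on
  naturals does.\<close>

lemma level_bound_minus_one:
  assumes "bound I k MM x \<ge> 0"
  shows "level (bound I k MM x - 1) = level (bound I k MM x) - 1"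
  using assms by (rule bound_nonnegE) (simp add: level_def one_extended_def nat_diff_distrib')

lemma bound_pos_iff:
  assumes "bound I k MM x \<ge> 0"
  shows "0 < bound I k MM x \<longleftrightarrow> 0 < level (bound I k MM x)"
  using assms by (rule bound_nonnegE) (simp add: level_def zero_extended_def)

lemma level_bound_successor:
  assumes "i \<in> I" "(x, z) \<in> rel M i"
    and "bound I k (M, wd) x \<ge> 0" "Suc m \<le> level (bound I k (M, wd) x)"
  shows "bound I k (M, wd) z \<ge> 0" "m \<le> level (bound I k (M, wd) z)"
proof -
  have le: "Fin (int m) \<le> bound I k (M, wd) z"
    using assms(4) by (intro bound_successor[OF assms(1,2)]) (simp only: le_level_iff[OF assms(3)])
  show nonneg: "bound I k (M, wd) z \<ge> 0"
    by (rule order_trans[OF _ le]) (simp add: zero_extended_def)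
  show "m \<le> level (bound I k (M, wd) z)"
    using le by (simp add: le_level_iff[OF nonneg])
qed

section \<open>Maximal worlds\<close>

lemma max_worldsD:
  assumes "x \<in> max_worlds P I k (M, wd)"
  shows "x \<in> worlds M" "bound I k (M, wd) x \<ge> 0"
  using assms by (auto simp: max_worlds_def)

text \<open>Otherwise the bisimilarity could be lowered to the level of \<open>y\<close>, and
  \<open>z\<close> would dominate \<open>y\<close>.\<close>

lemma max_worlds_level_ge:
  assumes "y \<in> max_worlds P I k (M, wd)" "world_bisim P I M m y z"
    and "bound I k (M, wd) z \<ge> 0" "m \<le> level (bound I k (M, wd) z)"
  shows "m \<le> level (bound I k (M, wd) y)"
proof (rule ccontr)
  assume "\<not> ?thesis"
  then have less: "level (bound I k (M, wd) y) < m" by simp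
  then have "world_bisim P I M (level (bound I k (M, wd) y)) z y"
    using world_bisim_mono[OF assms(2)] by (simp add: world_bisim_sym)
  moreover have "bound I k (M, wd) y < bound I k (M, wd) z"
    using less assms(4) by (simp add: bound_less_iff[OF max_worldsD(2)[OF assms(1)] assms(3)])
  ultimately have "dominates P I k (M, wd) z y"
    using assms max_worldsD(2)[OF assms(1)] by (simp add: dominates_def)
  then show False
    using assms(1) world_bisim_worlds[OF assms(2)] by (auto simp: max_worlds_def)
qed

text \<open>A class, as a set, does not show the level at which it was taken; maximality recovers
  it. Each world lies in the class of the other, so \<open>max_worlds_level_ge\<close> applies in
  both directions.\<close>

lemma rep_class_eqD:
  assumes "is_model P I M"
    and "x \<in> max_worlds P I k (M, wd)" "y \<in> max_worlds P I k (M, wd)"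
    and "rep_class P I k (M, wd) x = rep_class P I k (M, wd) y"
  shows "level (bound I k (M, wd) x) = level (bound I k (M, wd) y)"
    and "world_bisim P I M (level (bound I k (M, wd) x)) x y"
proof -
  have "y \<in> rep_class P I k (M, wd) y" "x \<in> rep_class P I k (M, wd) x"
    using assms(1) assms(2,3)[THEN max_worldsD(1)]
    by (auto simp: rep_class_def bisim_class_def world_bisim_refl)
  then have xy: "world_bisim P I M (level (bound I k (M, wd) x)) x y"
    and yx: "world_bisim P I M (level (bound I k (M, wd) y)) y x"
    using assms(4) by (auto simp: rep_class_def bisim_class_def)
  show "world_bisim P I M (level (bound I k (M, wd) x)) x y" by (fact xy)
  show "level (bound I k (M, wd) x) = level (bound I k (M, wd) y)"
    using max_worlds_level_ge[OF assms(2) world_bisim_sym[OF yx]]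
      max_worlds_level_ge[OF assms(3) world_bisim_sym[OF xy]]
      assms(2,3)[THEN max_worldsD(2)] by (intro order_antisym) auto
qed

lemma ex_max_world:
  assumes "is_model P I M" "u \<in> worlds M" "bound I k (M, wd) u \<ge> 0"
  shows "\<exists>y \<in> max_worlds P I k (M, wd).
    level (bound I k (M, wd) u) \<le> level (bound I k (M, wd) y) \<and>
    world_bisim P I M (level (bound I k (M, wd) u)) y u"
proof -
  let ?lv = "\<lambda>y. level (bound I k (M, wd) y)"
  \<comment> \<open>The level of bisimilarity to \<open>u\<close> stays fixed at
    \<open>?lv u\<close>, so one choice of greatest level in a finite set replaces an iterated
    passage to dominating worlds.\<close>
  define S where "S = {y \<in> worlds M. bound I k (M, wd) y \<ge> 0 \<and> ?lv u \<le> ?lv y \<and>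
    world_bisim P I M (?lv u) y u}"
  have fin: "finite S" using assms(1) by (simp add: S_def is_model_def)
  have "u \<in> S" using assms by (simp add: S_def world_bisim_refl)
  then have "Max (?lv ` S) \<in> ?lv ` S" using fin by (intro Max_in) auto
  then obtain y where y: "y \<in> S" and y_Max: "Max (?lv ` S) = ?lv y" by (rule imageE)
  have greatest: "?lv z \<le> ?lv y" if "z \<in> S" for z
    using Max_ge[of "?lv ` S" "?lv z"] fin that unfolding y_Max by simp
  have "\<not> dominates P I k (M, wd) z y" if "z \<in> worlds M" for z
  proof
    assume dom: "dominates P I k (M, wd) z y"
    then have less: "?lv y < ?lv z" by (auto simp: dominates_def bound_less_iff[symmetric])
    \<comment> \<open>Domination gives bisimilarity at \<open>?lv y\<close>, which is at least
      \<open>?lv u\<close>; hence a dominating world would again lie in \<open>S\<close>.\<close>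
    have "world_bisim P I M (?lv u) z y"
      using dom y world_bisim_mono[of P I M "?lv y" z y "?lv u"] by (simp add: dominates_def S_def)
    then have "z \<in> S"
      using that dom less y world_bisim_trans[of P I M "?lv u" z y u]
      by (simp add: dominates_def S_def)
    then show False using greatest[of z] less by simp
  qed
  then have "y \<in> max_worlds P I k (M, wd)" using y by (simp add: max_worlds_def S_def)
  then show ?thesis using y by (auto simp: S_def)
qed

section \<open>The bisimulation between a model and its contraction\<close>

theorem theorem4p1:
  fixes P :: "'p set" and I :: "'i set"
    and M :: "('w, 'i, 'p) model" and wd :: 'w and k :: nat
  assumes "countable P" and "finite I"
    and "is_pointed_model P I (M, wd)"
  shows "k_bisimilar P I k (M, wd) (rooted_contraction P I k (M, wd))"
proof -
  have model: "is_model P I M" and wd: "wd \<in> worlds M"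
    using assms(3) by (auto simp: is_pointed_model_def)
  let ?b = "bound I k (M, wd)"
  let ?lv = "\<lambda>y. level (?b y)"
  let ?max = "max_worlds P I k (M, wd)"
  let ?rep = "rep_class P I k (M, wd)"
  let ?M' = "fst (rooted_contraction P I k (M, wd))"
  \<comment> \<open>At level \<open>Suc h\<close> the guard on \<open>?lv y\<close> makes the
    representative's level positive, as outgoing edges of the contraction require.\<close>
  define Z where "Z h = {(x, ?rep y) | x y. y \<in> ?max \<and> h \<le> ?lv y \<and> world_bisim P I M h x y}" for h
  have root: "(wd, ?rep wd) \<in> Z h" if "h \<le> k" for h
    using that root_in_max_worlds[OF assms(3), of k] world_bisim_refl[OF model wd]
    by (auto simp: Z_def bound_root level_def)
  have rel_iff: "(c, d) \<in> rel ?M' i \<longleftrightarrow> (\<exists>x y z. c = ?rep x \<and> d = ?rep y \<and> x \<in> ?max \<and> y \<in> ?max \<and>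
      (x, z) \<in> rel M i \<and> world_bisim P I M (?lv x - 1) y z \<and> 0 < ?lv x)" for c d i
  proof -
    have "0 < ?b x \<longleftrightarrow> 0 < ?lv x" "level (?b x - 1) = ?lv x - 1" if "x \<in> ?max" for x
      using max_worldsD(2)[OF that] by (rule bound_pos_iff, rule level_bound_minus_one)
    then show ?thesis
      unfolding rooted_contraction_def by (simp cong: conj_cong) metis
  qed
  have dom: "Z 0 \<subseteq> worlds M \<times> worlds ?M'"
    by (auto simp: Z_def rooted_contraction_def dest: world_bisim_worlds)
  have decr: "Z (Suc h) \<subseteq> Z h" for h
    unfolding Z_def using world_bisim_mono[of P I M "Suc h" _ _ h] Suc_leD by blast
  have atoms: "x \<in> val M p \<longleftrightarrow> c \<in> val ?M' p" if prem: "(x, c) \<in> Z 0" "p \<in> P" for x c p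
  proof -
    obtain y where y: "c = ?rep y" "y \<in> ?max" "world_bisim P I M 0 x y"
      using prem by (auto simp: Z_def)
    \<comment> \<open>The valuation of a class is witnessed by some maximal representative, possibly
      not \<open>y\<close>; all of them agree on the atoms.\<close>
    have "y \<in> val M p" if "y' \<in> ?max" "?rep y' = ?rep y" "y' \<in> val M p" for y'
      using rep_class_eqD(2)[OF model that(1) y(2) that(2)] that(3) prem(2) world_bisim_val by metis
    then have "c \<in> val ?M' p \<longleftrightarrow> y \<in> val M p"
      using y by (auto simp: rooted_contraction_def)
    then show ?thesis using world_bisim_val[OF y(3) prem(2)] by simp
  qed
  have forward: "\<exists>d. (c, d) \<in> rel ?M' i \<and> (v, d) \<in> Z h"
    if prem: "(w, c) \<in> Z (Suc h)" "i \<in> I" "(w, v) \<in> rel M i" for w c h i v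
  proof -
    obtain x where x: "c = ?rep x" "x \<in> ?max" "Suc h \<le> ?lv x" "world_bisim P I M (Suc h) w x"
      using prem by (auto simp: Z_def)
    obtain u where u: "(x, u) \<in> rel M i" "world_bisim P I M h v u"
      using world_bisim_forth[OF x(4) prem(2,3)] by blast
    have bu: "?b u \<ge> 0" "?lv x - 1 \<le> ?lv u"
      using level_bound_successor[OF prem(2) u(1) max_worldsD(2)[OF x(2)], of "?lv x - 1"] x(3)
      by auto
    \<comment> \<open>The maximal world is chosen for \<open>u\<close>, not for \<open>v\<close>:
      the level of \<open>x\<close> controls the bound of \<open>u\<close>, whereas
      \<open>w\<close>, and so \<open>v\<close>, may have any bound. Since \<open>?lv u\<close> is
      at least \<open>?lv x - 1\<close>, the choice meets the edge condition.\<close>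
    obtain y where y: "y \<in> ?max" "?lv u \<le> ?lv y" "world_bisim P I M (?lv u) y u"
      using ex_max_world[OF model world_bisim_worlds(2)[OF u(2)] bu(1)] by blast
    have "(c, ?rep y) \<in> rel ?M' i"
      using x(1-3) y(1) u(1) world_bisim_mono[OF y(3) bu(2)] unfolding rel_iff
      by (intro exI[of _ x] exI[of _ y] exI[of _ u]) simp
    moreover have h: "h \<le> ?lv u" using bu(2) x(3) by simp
    have "world_bisim P I M h v y"
      by (rule world_bisim_trans[OF u(2) world_bisim_sym[OF world_bisim_mono[OF y(3) h]]])
    then have "(v, ?rep y) \<in> Z h"
      using y(1,2) h by (auto simp: Z_def)
    ultimately show ?thesis by blast
  qed
  have backward: "\<exists>v. (w, v) \<in> rel M i \<and> (v, d) \<in> Z h"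
    if prem: "(w, c) \<in> Z (Suc h)" "i \<in> I" "(c, d) \<in> rel ?M' i" for w c h i d
  proof -
    obtain x0 where x0: "c = ?rep x0" "x0 \<in> ?max" "Suc h \<le> ?lv x0" "world_bisim P I M (Suc h) w x0"
      using prem by (auto simp: Z_def)
    obtain x y z where x: "c = ?rep x" "x \<in> ?max" and y: "d = ?rep y" "y \<in> ?max"
      and z: "(x, z) \<in> rel M i" "world_bisim P I M (?lv x - 1) y z"
      using prem(3) unfolding rel_iff by blast
    \<comment> \<open>The edge may come from a representative \<open>x\<close> other than the
      \<open>x0\<close> supplied by \<open>Z\<close>; equal classes give equal levels and
      bisimilarity, so \<open>w\<close> can be compared with \<open>x\<close>.\<close>
    have eq: "?lv x0 = ?lv x" "world_bisim P I M (?lv x0) x0 x"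
      using rep_class_eqD[OF model x0(2) x(2)] x0(1) x(1) by auto
    have "world_bisim P I M (Suc h) x w"
      by (rule world_bisim_sym[OF world_bisim_trans[OF x0(4) world_bisim_mono[OF eq(2) x0(3)]]])
    then obtain v where v: "(w, v) \<in> rel M i" "world_bisim P I M h z v"
      using world_bisim_forth[OF _ prem(2) z(1)] by blast
    have h: "h \<le> ?lv x - 1" using x0(3) eq(1) by simp
    have yz: "world_bisim P I M h y z" using world_bisim_mono[OF z(2) h] .
    \<comment> \<open>This bound on \<open>z\<close> lets maximality of \<open>y\<close> yield
      \<open>h \<le> ?lv y\<close>, the guard in \<open>Z h\<close>.\<close>
    have "?b z \<ge> 0" "h \<le> ?lv z"
      using level_bound_successor[OF prem(2) z(1) max_worldsD(2)[OF x(2)], of h] x0(3) eq(1) by auto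
    then have "h \<le> ?lv y" using max_worlds_level_ge[OF y(2) yz] by blast
    then have "(v, d) \<in> Z h"
      using y world_bisim_sym[OF world_bisim_trans[OF yz v(2)]] by (auto simp: Z_def)
    then show ?thesis using v(1) by blast
  qed
  have "k_bisimulation P I k (M, wd) (?M', ?rep wd) Z"
    by (rule k_bisimulationI[OF decr root dom atoms forward backward])
  then show ?thesis
    by (auto simp: k_bisimilar_def rooted_contraction_def)
qed

end
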